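(* Let $\mathbb{K}$ be an arbitrary field, let $k$ be a positive integer, let $\{A_1,\dots,A_k\}$ be a partition of a set $X$, and let $$M=\bigcup_{1\leq j\leq q\leq k}A_q\times A_j\subseteq X\times X,$$ equipped with the partial ordering $\prec$ generated by the partition $\{A_1,\dots,A_k\}$. Assume that $\{f_\alpha\}_{\alpha\in\Lambda}$ is a family of homogeneous degree $2$ elements of the free algebra $\mathbb{K}\langle X\rangle$ such that $\bigcup_{\alpha\in\Lambda}\operatorname{supp}(f_\alpha)=M$ and each $\operatorname{supp}(f_\alpha)$ is a chain in $M$ with respect to $\prec$. Then the algebra $R=\mathbb{K}\langle X\rangle/I$, where $I$ is the two-sided ideal generated by $\{f_\alpha:\alpha\in\Lambda\}$, is $(k+1)$-step nilpotent.
   Context: $\mathbb{K}\langle X\rangle$ is the free associative $\mathbb{K}$-algebra generated by $X$. A partition $\{A_1,\dots,A_k\}$ of $X$ here means that $X$ is the union of the pairwise disjoint sets $A_1,\dots,A_k$ (which may be empty), indexed in this order. The partial ordering $\prec$ on $M$ generated by the partition is defined as follows: for distinct elements $(a,b)$ and $(c,d)$ of $M$, $(a,b)\prec(c,d)$ if $(a,b)\in A_l\times A_j$ and $(c,d)\in A_m\times A_r$ with $m\geq r>l\geq j$. For a homogeneous degree $2$ element $g\in\mathbb{K}\langle X\rangle$, $\operatorname{supp}(g)$ is the unique finite subset $S$ of $X\times X$ such that $g=\sum_{(x,y)\in S}c_{x,y}xy$ with all $c_{x,y}\in\mathbb{K}\setminus\{0\}$. The quotient $R$ of $\mathbb{K}\langle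 X\rangle$ by an ideal generated by homogeneous elements inherits the degree grading; $R_q$ denotes its $q$-th homogeneous component. A graded algebra $R$ is called $m$-step nilpotent if $R_m=\{0\}$. *)

theory Defs
  imports "HOL-Library.Poly_Mapping" "HOL-Library.Disjoint_Sets" "HOL-Algebra.QuotRing"
begin

section \<open>The free associative algebra\<close>

text \<open>Words under concatenation form a monoid, written additively because that is what the
  convolution product of \<open>Poly_Mapping\<close> expects.  With this instance, \<open>'x list \<Rightarrow>\<^sub>0 'k\<close> is the
  monoid algebra of the free monoid over \<open>'x\<close>.\<close>

instantiation list :: (type) monoid_add
begin

definition zero_list :: "'a list" where "zero_list = []"
definition plus_list :: "'a list \<Rightarrow> 'a list \<Rightarrow> 'a list" where "plus_list u v = u @ v"

instance by standard (simp_all add: zero_list_def plus_list_def)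

end

definition free_algebra :: "'x set \<Rightarrow> ('x list \<Rightarrow>\<^sub>0 'k::field) ring" where
  "free_algebra X = \<lparr>carrier = {p. Poly_Mapping.keys p \<subseteq> lists X}, mult = (*), one = 1, zero = 0, add = (+)\<rparr>"

definition homogeneous_component :: "'x set \<Rightarrow> nat \<Rightarrow> ('x list \<Rightarrow>\<^sub>0 'k::field) set" where
  "homogeneous_component X q =
     {p \<in> carrier (free_algebra X). \<forall>w \<in> Poly_Mapping.keys p. length w = q}"

text \<open>Ideals of \<^term>\<open>free_algebra X\<close> as a ring are closed under scalars (the algebra is
  unital), so the ring-theoretic ideal and quotient of HOL-Algebra are the algebra ones.\<close>

lemma ring_free_algebra: "ring (free_algebra X :: ('x list \<Rightarrow>\<^sub>0 'k::field) ring)"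
proof -
  have mult: "Poly_Mapping.keys (p * q) \<subseteq> lists X"
    if "Poly_Mapping.keys p \<subseteq> lists X" "Poly_Mapping.keys q \<subseteq> lists X"
    for p q :: "'x list \<Rightarrow>\<^sub>0 'k"
  proof
    fix w assume "w \<in> Poly_Mapping.keys (p * q)"
    then obtain u v where "w = u + v" "u \<in> Poly_Mapping.keys p" "v \<in> Poly_Mapping.keys q"
      using keys_mult[of p q] by blast
    then show "w \<in> lists X"
      using that by (auto simp: plus_list_def)
  qed
  have add: "Poly_Mapping.keys (p + q) \<subseteq> lists X"
    if "Poly_Mapping.keys p \<subseteq> lists X" "Poly_Mapping.keys q \<subseteq> lists X"
    for p q :: "'x list \<Rightarrow>\<^sub>0 'k"
    using that keys_add[of p q] by blast
  show ?thesis
  proof (rule ringI)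
    show "abelian_group (free_algebra X :: ('x list \<Rightarrow>\<^sub>0 'k) ring)"
    proof (rule abelian_groupI)
      fix p :: "'x list \<Rightarrow>\<^sub>0 'k"
      assume "p \<in> carrier (free_algebra X)"
      then show "\<exists>q\<in>carrier (free_algebra X). q \<oplus>\<^bsub>free_algebra X\<^esub> p = \<zero>\<^bsub>free_algebra X\<^esub>"
        by (intro bexI[of _ "- p"]) (simp_all add: free_algebra_def in_keys_iff subset_iff)
    qed (use add in \<open>auto simp: free_algebra_def algebra_simps\<close>)
    show "Group.monoid (free_algebra X :: ('x list \<Rightarrow>\<^sub>0 'k) ring)"
    proof (rule Group.monoidI)
      have "Poly_Mapping.keys (1 :: 'x list \<Rightarrow>\<^sub>0 'k) \<subseteq> lists X"
        by (simp flip: single_one) (simp add: zero_list_def)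
      then show "\<one>\<^bsub>free_algebra X\<^esub> \<in> carrier (free_algebra X :: ('x list \<Rightarrow>\<^sub>0 'k) ring)"
        by (simp add: free_algebra_def)
    qed (use mult in \<open>auto simp: free_algebra_def mult.assoc\<close>)
  qed (auto simp: free_algebra_def algebra_simps)
qed

definition quotient_component ::
    "'x set \<Rightarrow> ('x list \<Rightarrow>\<^sub>0 'k::field) set \<Rightarrow> nat \<Rightarrow> ('x list \<Rightarrow>\<^sub>0 'k) set set" where
  "quotient_component X I q = (\<lambda>p. I +>\<^bsub>free_algebra X\<^esub> p) ` homogeneous_component X q"

text \<open>A grading of \<open>R\<close> is given by the family \<open>H\<close> of its homogeneous components.\<close>

definition step_nilpotent :: "('a, 'b) ring_scheme \<Rightarrow> (nat \<Rightarrow> 'a set) \<Rightarrow> nat \<Rightarrow> bool" where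
  "step_nilpotent R H m \<longleftrightarrow> H m = {\<zero>\<^bsub>R\<^esub>}"

text \<open>Meaningful for \<open>g\<close> homogeneous of degree 2 only.\<close>

definition supp :: "'x set \<Rightarrow> ('x list \<Rightarrow>\<^sub>0 'k::field) \<Rightarrow> ('x \<times> 'x) set" where
  "supp X g = (THE S. finite S \<and> S \<subseteq> X \<times> X \<and>
     (\<exists>c. (\<forall>s\<in>S. c s \<noteq> 0) \<and> g = (\<Sum>(x, y)\<in>S. Poly_Mapping.single [x, y] (c (x, y)))))"

lemma lookup_sum_pairs:
  assumes "finite S"
  shows "Poly_Mapping.lookup (\<Sum>(x, y)\<in>S. Poly_Mapping.single [x, y] (c (x, y))) [a, b]
    = (if (a, b) \<in> S then c (a, b) else (0::'k::field))"
proof -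
  have "Poly_Mapping.lookup (\<Sum>(x, y)\<in>S. Poly_Mapping.single [x, y] (c (x, y))) [a, b]
      = (\<Sum>s\<in>S. if s = (a, b) then c s else 0)"
    unfolding lookup_sum by (intro sum.cong) (auto simp: lookup_single when_def split: if_splits)
  then show ?thesis
    using assms by simp
qed

lemma supp_eq:
  fixes g :: "'x list \<Rightarrow>\<^sub>0 'k::field"
  assumes "g \<in> homogeneous_component X 2"
  shows "supp X g = {(x, y). Poly_Mapping.lookup g [x, y] \<noteq> 0}"
  unfolding supp_def
proof (rule the_equality)
  let ?S = "{(x, y). Poly_Mapping.lookup g [x, y] \<noteq> 0}"
  let ?c = "\<lambda>(x, y). Poly_Mapping.lookup g [x, y]"
  have keys: "w \<in> lists X \<and> length w = 2" if "Poly_Mapping.lookup g w \<noteq> 0" for w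
    using assms that by (auto simp: homogeneous_component_def free_algebra_def in_keys_iff)
  have "inj_on (\<lambda>(x, y). [x, y]) ?S"
    by (auto simp: inj_on_def)
  moreover have "(\<lambda>(x, y). [x, y]) ` ?S \<subseteq> Poly_Mapping.keys g"
    by (auto simp: in_keys_iff)
  ultimately have fin: "finite ?S"
    by (meson finite_imageD finite_keys finite_subset)
  have "g = (\<Sum>(x, y)\<in>?S. Poly_Mapping.single [x, y] (?c (x, y)))" (is "_ = ?g")
  proof (rule poly_mapping_eqI)
    fix w
    show "Poly_Mapping.lookup g w = Poly_Mapping.lookup ?g w"
    proof (cases "length w = 2")
      case True
      then obtain a b where "w = [a, b]"
        by (auto simp: numeral_2_eq_2 length_Suc_conv)
      then show ?thesis
        using lookup_sum_pairs[OF fin, of ?c a b] by auto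
    next
      case False
      then have "Poly_Mapping.lookup ?g w = 0"
        unfolding lookup_sum by (intro sum.neutral) (auto simp: lookup_single when_def)
      then show ?thesis
        using keys False by auto
    qed
  qed
  moreover have "?S \<subseteq> X \<times> X" "\<forall>s\<in>?S. ?c s \<noteq> 0"
    using keys by fastforce+
  ultimately show "finite ?S \<and> ?S \<subseteq> X \<times> X \<and>
      (\<exists>c. (\<forall>s\<in>?S. c s \<noteq> 0) \<and> g = (\<Sum>(x, y)\<in>?S. Poly_Mapping.single [x, y] (c (x, y))))"
    using fin by blast
next
  fix S
  assume "finite S \<and> S \<subseteq> X \<times> X \<and>
    (\<exists>c. (\<forall>s\<in>S. c s \<noteq> 0) \<and> g = (\<Sum>(x, y)\<in>S. Poly_Mapping.single [x, y] (c (x, y))))"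
  then show "S = {(x, y). Poly_Mapping.lookup g [x, y] \<noteq> 0}"
    by (auto simp: lookup_sum_pairs split: if_splits)
qed

section \<open>The partially ordered set generated by a partition\<close>

definition indexed_partition :: "nat \<Rightarrow> (nat \<Rightarrow> 'x set) \<Rightarrow> 'x set \<Rightarrow> bool" where
  "indexed_partition k A X \<longleftrightarrow> X = (\<Union>i\<in>{1..k}. A i) \<and> disjoint_family_on A {1..k}"

definition pair_set :: "nat \<Rightarrow> (nat \<Rightarrow> 'x set) \<Rightarrow> ('x \<times> 'x) set" where
  "pair_set k A = (\<Union>q\<in>{1..k}. \<Union>j\<in>{1..q}. A q \<times> A j)"

definition pair_prec :: "nat \<Rightarrow> (nat \<Rightarrow> 'x set) \<Rightarrow> 'x \<times> 'x \<Rightarrow> 'x \<times> 'x \<Rightarrow> bool" where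
  "pair_prec k A u v \<longleftrightarrow> u \<in> pair_set k A \<and> v \<in> pair_set k A \<and> u \<noteq> v \<and>
     (\<exists>l\<in>{1..k}. \<exists>j\<in>{1..k}. \<exists>m\<in>{1..k}. \<exists>r\<in>{1..k}.
        u \<in> A l \<times> A j \<and> v \<in> A m \<times> A r \<and> m \<ge> r \<and> r > l \<and> l \<ge> j)"

lemma pair_prec_trans:
  assumes "indexed_partition k A X" "pair_prec k A u v" "pair_prec k A v w"
  shows "pair_prec k A u w"
proof -
  have uniq: "i = i'" if "x \<in> A i" "x \<in> A i'" "i \<in> {1..k}" "i' \<in> {1..k}" for x i i'
    using assms(1) that unfolding indexed_partition_def disjoint_family_on_def by blast
  obtain l j m r where 1: "l \<in> {1..k}" "j \<in> {1..k}" "m \<in> {1..k}" "r \<in> {1..k}"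
    "u \<in> A l \<times> A j" "v \<in> A m \<times> A r" "m \<ge> r" "r > l" "l \<ge> j"
    using assms(2) unfolding pair_prec_def by blast
  obtain l' j' m' r' where 2: "l' \<in> {1..k}" "j' \<in> {1..k}" "m' \<in> {1..k}" "r' \<in> {1..k}"
    "v \<in> A l' \<times> A j'" "w \<in> A m' \<times> A r'" "m' \<ge> r'" "r' > l'" "l' \<ge> j'"
    using assms(3) unfolding pair_prec_def by blast
  have "l' = m"
    using uniq[of "fst v" l' m] 1 2 by (auto simp: mem_Times_iff)
  then have lt: "r' > l"
    using 1 2 by linarith
  have "u \<noteq> w"
  proof
    assume "u = w"
    then have "l = m'"
      using uniq[of "fst u" l m'] 1 2 by (auto simp: mem_Times_iff)
    then show False
      using lt 2 by linarith
  qed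
  then show ?thesis
    using assms(2,3) 1 2 lt unfolding pair_prec_def by blast
qed

end

theory Submission
  imports Defs
begin

text \<open>Write \<open>W j\<close> for the index of the part containing the letter at place \<open>j\<close> (from 0) of a word
  of length \<open>k + 1\<close>.  As \<open>1 \<le> W 0\<close> and \<open>W k \<le> k\<close>, there is a least place \<open>m > 0\<close> with \<open>W m \<le> m\<close>, and the
  pair of letters at \<open>m - 1\<close>, \<open>m\<close> then lies in \<open>M\<close>.  A relation containing that pair rewrites the word
  into words in which the pair is replaced by a larger or a smaller one.  In the first case \<open>W (m - 1)\<close>
  increases and \<open>m\<close> increases, in the second case \<open>m\<close> drops to \<open>m - 1\<close>.  Either way the sequence
  \<open>2 W 0, \<dots>, 2 W (m - 2), 2 W (m - 1) + 1\<close> increases lexicographically, so rewriting terminates,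
  and it can only terminate in 0.\<close>

section \<open>The rewriting measure\<close>

definition first_low :: "(nat \<Rightarrow> nat) \<Rightarrow> nat" where
  "first_low W = (LEAST m. W m \<le> m)"

text \<open>The lexicographic order of the sequences above, read as numerals to the base \<open>2 k + 2\<close>.\<close>

definition rank :: "nat \<Rightarrow> (nat \<Rightarrow> nat) \<Rightarrow> nat" where
  "rank k W = (\<Sum>j<first_low W. 2 * W j * (2 * k + 2) ^ (k - j)) + (2 * k + 2) ^ (k + 1 - first_low W)"

lemma first_low_le: "W k \<le> k \<Longrightarrow> first_low W \<le> k"
  unfolding first_low_def by (rule Least_le)

lemma first_low_low: "W k \<le> k \<Longrightarrow> W (first_low W) \<le> first_low W"
  unfolding first_low_def by (rule LeastI)

lemma less_first_lowD: "j < first_low W \<Longrightarrow> j < W j"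
  unfolding first_low_def using not_less_Least by fastforce

text \<open>The bound is crude, but it does not depend on \<open>W\<close>; this turns the increase
  of \<open>rank\<close> under rewriting into a terminating descent.\<close>

lemma rank_le:
  assumes "\<And>j. j \<le> k \<Longrightarrow> W j \<le> k"
  shows "rank k W \<le> (\<Sum>j<k. 2 * k * (2 * k + 2) ^ k) + (2 * k + 2) ^ (k + 1)"
proof -
  have "first_low W \<le> k"
    using assms by (simp add: first_low_le)
  then have "(\<Sum>j<first_low W. 2 * W j * (2 * k + 2) ^ (k - j)) \<le> (\<Sum>j<first_low W. 2 * k * (2 * k + 2) ^ k)"
    using assms by (intro sum_mono mult_mono power_increasing) auto
  also have "\<dots> \<le> (\<Sum>j<k. 2 * k * (2 * k + 2) ^ k)"
    using \<open>first_low W \<le> k\<close> by (intro sum_mono2) auto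
  finally show ?thesis
    unfolding rank_def by (intro add_mono power_increasing) auto
qed

text \<open>Covers replacing the pair at places \<open>i\<close>, \<open>Suc i\<close> by a larger
  one. The digit at \<open>i\<close> grows from \<open>2 * W i + 1\<close> to
  \<open>2 * W' i\<close>, and all later digits only add to the rank.\<close>

lemma rank_less_up:
  assumes "first_low W = Suc i" "\<And>j. j < i \<Longrightarrow> W' j = W j"
    and "W i < W' i" "Suc i < W' (Suc i)" "W' k \<le> k"
  shows "rank k W < rank k W'"
proof -
  let ?B = "2 * k + 2"
  \<comment> \<open>Before \<open>i\<close> the values are those of \<open>W\<close>, and at
    \<open>i\<close> one has \<open>W' i > W i > i\<close>.\<close>
  have "j < W' j" if "j \<le> Suc i" for j
    using that assms less_first_lowD[of j W] less_first_lowD[of i W]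
    by (cases "j < i"; cases "j = i") (auto simp: less_Suc_eq le_Suc_eq)
  then have low: "Suc i < first_low W'"
    using first_low_low[of W' k] assms(5) by (meson leD not_le_imp_less)
  then have "Suc i \<le> k"
    using first_low_le[of W' k] assms(5) by linarith
  \<comment> \<open>As \<open>k + 1 - Suc i = k - i\<close>, the closing power of
    \<open>rank\<close> merges with the digit at \<open>i\<close> and makes it odd.\<close>
  have "rank k W = (\<Sum>j<i. 2 * W j * ?B ^ (k - j)) + (2 * W i + 1) * ?B ^ (k - i)"
    by (simp add: rank_def assms(1) algebra_simps)
  also have "\<dots> < (\<Sum>j<i. 2 * W' j * ?B ^ (k - j)) + 2 * W' i * ?B ^ (k - i)"
    using assms by (intro add_le_less_mono mult_strict_right_mono) auto
  also have "\<dots> = (\<Sum>j<Suc i. 2 * W' j * ?B ^ (k - j))"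
    by simp
  also have "\<dots> \<le> (\<Sum>j<first_low W'. 2 * W' j * ?B ^ (k - j))"
    using low by (intro sum_mono2) auto
  also have "\<dots> \<le> rank k W'"
    by (simp add: rank_def)
  finally show ?thesis .
qed

text \<open>Covers replacing the pair by a smaller one. Now \<open>i\<close> is the first low place,
  so the value \<open>W' i\<close> no longer enters the rank. The closing power grows from
  \<open>?B ^ (k - i)\<close> to \<open>?B ^ (k + 1 - i)\<close>, which outweighs the lost digit
  because \<open>2 * W i + 1 < ?B\<close>.\<close>

lemma rank_less_down:
  assumes "first_low W = Suc i" "i \<le> k" "\<And>j. j < i \<Longrightarrow> W' j = W j"
    and "W i \<le> k" "W' i \<le> i"
  shows "rank k W < rank k W'"
proof -
  let ?B = "2 * k + 2"
  have "i \<le> j" if "W' j \<le> j" for j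
    using that assms(1,3) less_first_lowD[of j W] by (cases "j < i") auto
  then have low: "first_low W' = i"
    unfolding first_low_def using assms(5) by (intro Least_equality)
  have "rank k W = (\<Sum>j<i. 2 * W j * ?B ^ (k - j)) + (2 * W i + 1) * ?B ^ (k - i)"
    by (simp add: rank_def assms(1) algebra_simps)
  also have "\<dots> < (\<Sum>j<i. 2 * W' j * ?B ^ (k - j)) + ?B * ?B ^ (k - i)"
    using assms by (intro add_le_less_mono mult_strict_right_mono) auto
  also have "\<dots> = rank k W'"
    using \<open>i \<le> k\<close> by (simp add: rank_def low Suc_diff_le)
  finally show ?thesis .
qed

section \<open>Ideals of the free algebra\<close>

lemma single_in_free_algebra:
  "w \<in> lists X \<Longrightarrow> Poly_Mapping.single w c \<in> carrier (free_algebra X)"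
  by (auto simp: free_algebra_def)

lemma sum_single_lookup:
  "(\<Sum>w\<in>Poly_Mapping.keys p. Poly_Mapping.single w (Poly_Mapping.lookup p w)) = p"
  by (rule poly_mapping_eqI)
     (simp add: lookup_sum lookup_single when_def in_keys_iff)

lemma ideal_free_algebra_add:
  assumes "ideal I (free_algebra X)" "p \<in> I" "q \<in> I"
  shows "p + q \<in> I"
  using additive_subgroup.a_closed[OF ideal.axioms(1)[OF assms(1)] assms(2,3)]
  by (simp add: free_algebra_def)

lemma ideal_free_algebra_sum:
  assumes "ideal I (free_algebra X)" "\<And>s. s \<in> S \<Longrightarrow> p s \<in> I"
  shows "sum p S \<in> I"
proof -
  have "0 \<in> I"
    using additive_subgroup.zero_closed[OF ideal.axioms(1)[OF assms(1)]]
    by (simp add: free_algebra_def)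
  then show ?thesis
    using assms(2)
    by (induction S rule: infinite_finite_induct)
       (auto intro: ideal_free_algebra_add[OF assms(1)])
qed

lemma ideal_free_algebra_mult:
  assumes "ideal I (free_algebra X)" "p \<in> I" "q \<in> carrier (free_algebra X)"
  shows "q * p \<in> I" "p * q \<in> I"
  using ideal.I_l_closed[OF assms] ideal.I_r_closed[OF assms] by (simp_all add: free_algebra_def)

lemma ideal_free_algebra_single:
  assumes "ideal I (free_algebra X)" "Poly_Mapping.single w (c :: 'k::field) \<in> I" "c \<noteq> 0"
  shows "Poly_Mapping.single w d \<in> I"
proof -
  \<comment> \<open>Scalars are the multiples of the empty word.\<close>
  have "Poly_Mapping.single [] (d / c) * Poly_Mapping.single w c \<in> I"
    using assms by (intro ideal_free_algebra_mult[OF assms(1)] single_in_free_algebra) auto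
  then show ?thesis
    using assms(3) by (simp add: mult_single plus_list_def)
qed

lemma ideal_free_algebra_keys:
  assumes "ideal I (free_algebra X)"
    and "\<And>w. w \<in> Poly_Mapping.keys p \<Longrightarrow> Poly_Mapping.single w (1 :: 'k::field) \<in> I"
  shows "p \<in> I"
proof -
  have "(\<Sum>w\<in>Poly_Mapping.keys p. Poly_Mapping.single w (Poly_Mapping.lookup p w)) \<in> I"
    using assms by (intro ideal_free_algebra_sum[OF assms(1)])
      (auto intro: ideal_free_algebra_single[where c = 1])
  then show ?thesis
    by (simp add: sum_single_lookup)
qed

text \<open>One rewriting step: modulo \<open>I\<close>, the relation \<open>u * g * v = 0\<close>
  expresses the word \<open>u @ z @ v\<close> through the other words \<open>u @ z' @ v\<close>,
  since the coefficient of \<open>z\<close> in \<open>g\<close> is invertible.\<close>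

lemma ideal_free_algebra_rewrite:
  fixes g :: "'x list \<Rightarrow>\<^sub>0 'k::field"
  assumes I: "ideal I (free_algebra X)" and "g \<in> I" and uv: "u \<in> lists X" "v \<in> lists X"
    and z: "z \<in> Poly_Mapping.keys g"
    and others: "\<And>z'. z' \<in> Poly_Mapping.keys g \<Longrightarrow> z' \<noteq> z \<Longrightarrow> Poly_Mapping.single (u @ z' @ v) (1 :: 'k) \<in> I"
  shows "Poly_Mapping.single (u @ z @ v) (1 :: 'k) \<in> I"
proof -
  let ?t = "\<lambda>z. Poly_Mapping.single (u @ z @ v) (Poly_Mapping.lookup g z)"
  have "Poly_Mapping.single u 1 * g * Poly_Mapping.single v 1 \<in> I"
    using \<open>g \<in> I\<close> uv by (intro ideal_free_algebra_mult[OF I] single_in_free_algebra)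
  moreover have "Poly_Mapping.single u 1 * g * Poly_Mapping.single v 1 = (\<Sum>z\<in>Poly_Mapping.keys g. ?t z)"
    by (subst sum_single_lookup[symmetric, of g])
       (simp add: sum_distrib_left sum_distrib_right mult_single plus_list_def)
  moreover have "(\<Sum>z\<in>Poly_Mapping.keys g. ?t z) = ?t z + (\<Sum>z'\<in>Poly_Mapping.keys g - {z}. ?t z')"
    using z by (intro sum.remove) auto
  moreover have "(\<Sum>z'\<in>Poly_Mapping.keys g - {z}. Poly_Mapping.single (u @ z' @ v) (- Poly_Mapping.lookup g z')) \<in> I"
    using others by (intro ideal_free_algebra_sum[OF I])
      (auto intro: ideal_free_algebra_single[OF I, where c = 1])
  ultimately have "?t z \<in> I"
    using ideal_free_algebra_add[OF I] by (fastforce simp: single_uminus sum_negf)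
  then show ?thesis
    using z by (auto simp: in_keys_iff intro: ideal_free_algebra_single[OF I])
qed

section \<open>Vanishing of long words\<close>

text \<open>Disjointness makes the index of the part a function of the letter, so that the order on
  pairs becomes a set of inequalities between numbers.\<close>

lemma indexed_partition_class:
  assumes "indexed_partition k A X"
  obtains c where "\<And>x. x \<in> X \<Longrightarrow> c x \<in> {1..k}"
    and "\<And>x i. i \<in> {1..k} \<Longrightarrow> x \<in> A i \<longleftrightarrow> x \<in> X \<and> c x = i"
proof -
  have "\<forall>x\<in>X. \<exists>i\<in>{1..k}. x \<in> A i"
    using assms unfolding indexed_partition_def by blast
  then obtain c where c: "\<And>x. x \<in> X \<Longrightarrow> c x \<in> {1..k} \<and> x \<in> A (c x)"
    by metis
  moreover have "x \<in> A i \<longleftrightarrow> x \<in> X \<and> c x = i" if "i \<in> {1..k}" for x i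
    using assms c that unfolding indexed_partition_def disjoint_family_on_def by blast
  ultimately show ?thesis
    using that by blast
qed

lemma long_word_in_ideal:
  fixes f :: "'l \<Rightarrow> ('x list \<Rightarrow>\<^sub>0 'k::field)"
  assumes part: "indexed_partition k A X"
    and hom: "\<And>\<alpha>. \<alpha> \<in> \<Lambda> \<Longrightarrow> f \<alpha> \<in> homogeneous_component X 2"
    and cover: "pair_set k A \<subseteq> (\<Union>\<alpha>\<in>\<Lambda>. supp X (f \<alpha>))"
    and chain: "\<And>\<alpha>. \<alpha> \<in> \<Lambda> \<Longrightarrow> pred_on.chain (pair_set k A) (pair_prec k A) (supp X (f \<alpha>))"
    and I: "ideal I (free_algebra X)" and fI: "f ` \<Lambda> \<subseteq> I"
    and "w \<in> lists X" "length w = k + 1"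
  shows "Poly_Mapping.single w (1 :: 'k) \<in> I"
proof -
  obtain c where c: "\<And>x. x \<in> X \<Longrightarrow> c x \<in> {1..k}"
    and A: "\<And>x i. i \<in> {1..k} \<Longrightarrow> x \<in> A i \<longleftrightarrow> x \<in> X \<and> c x = i"
    using indexed_partition_class[OF part] by metis
  have prec: "c x < c y' \<and> c y' \<le> c x' \<and> c y \<le> c x"
    if "pair_prec k A (x, y) (x', y')" for x y x' y'
    using that unfolding pair_prec_def by (auto simp: A)
  \<comment> \<open>Places beyond \<open>k\<close> carry unspecified values; they are harmless,
    because the first low place is at most \<open>k\<close> and \<open>rank\<close> reads only the
    places before it.\<close>
  let ?W = "\<lambda>w j. c (w ! j)"
  define N where "N = (\<Sum>j<k. 2 * k * (2 * k + 2) ^ k) + (2 * k + 2) ^ (k + 1)"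
  show ?thesis
    using assms(7,8)
  proof (induction w rule: measure_induct_rule[where f = "\<lambda>w. N - rank k (?W w)"])
    case (less w)
    have W: "?W v j \<in> {1..k}" if "v \<in> lists X" "length v = k + 1" "j \<le> k" for v j
      using that by (intro c) (auto simp: in_lists_conv_set)
    have IH: "Poly_Mapping.single v (1 :: 'k) \<in> I"
      if "v \<in> lists X" "length v = k + 1" "rank k (?W w) < rank k (?W v)" for v
    proof (rule less.IH)
      have "rank k (?W v) \<le> N"
        unfolding N_def using W that by (intro rank_le) auto
      then show "N - rank k (?W v) < N - rank k (?W w)"
        using that by linarith
    qed (use that in auto)
    \<comment> \<open>Indices of parts start at 1, so place 0 is never low and the first low place
      has a predecessor \<open>i\<close>.\<close>
    have "first_low (?W w) \<noteq> 0"
      using W[OF less.prems, of 0] W[OF less.prems, of k] first_low_low[of "?W w" k]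
      by (intro notI) auto
    then obtain i where i: "first_low (?W w) = Suc i"
      using not0_implies_Suc by blast
    then have "Suc i \<le> k"
      using first_low_le[of "?W w" k] W[OF less.prems, of k] by simp
    define u x y v where "u = take i w" and "x = w ! i" and "y = w ! Suc i" and "v = drop (i + 2) w"
    have w: "w = u @ [x, y] @ v"
      unfolding u_def x_def y_def v_def using \<open>Suc i \<le> k\<close> less.prems(2)
      by (simp add: Cons_nth_drop_Suc)
    have len: "length u = i"
      using \<open>Suc i \<le> k\<close> less.prems(2) by (simp add: u_def)
    have X: "u \<in> lists X" "v \<in> lists X" "x \<in> X" "y \<in> X"
      using less.prems(1) by (auto simp: w)
    have cx: "i < c x"
      using less_first_lowD[of i "?W w"] i by (simp add: x_def)
    have cy: "c y \<le> Suc i"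
      using first_low_low[of "?W w" k] W[OF less.prems, of k] i by (simp add: y_def)
    \<comment> \<open>Place \<open>i\<close> is not low and \<open>Suc i\<close> is, hence
      \<open>c y \<le> Suc i \<le> c x\<close>.\<close>
    have "(x, y) \<in> A (c x) \<times> A (c y)" "c y \<in> {1..c x}" "c x \<in> {1..k}"
      using X A c[of x] c[of y] cx cy by auto
    then have "(x, y) \<in> pair_set k A"
      unfolding pair_set_def by blast
    then obtain \<alpha> where \<alpha>: "\<alpha> \<in> \<Lambda>" "(x, y) \<in> supp X (f \<alpha>)"
      using cover by blast
    have "Poly_Mapping.single (u @ [x, y] @ v) (1 :: 'k) \<in> I"
    proof (rule ideal_free_algebra_rewrite[OF I])
      show "f \<alpha> \<in> I" "u \<in> lists X" "v \<in> lists X"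
        using fI \<alpha> X by auto
      show "[x, y] \<in> Poly_Mapping.keys (f \<alpha>)"
        using \<alpha> by (simp add: supp_eq[OF hom] in_keys_iff)
    next
      fix z assume z: "z \<in> Poly_Mapping.keys (f \<alpha>)" "z \<noteq> [x, y]"
      then have "z \<in> lists X" "length z = 2"
        using hom[OF \<alpha>(1)] by (auto simp: homogeneous_component_def free_algebra_def)
      then obtain x' y' where xy': "z = [x', y']" "x' \<in> X" "y' \<in> X"
        by (auto simp: numeral_2_eq_2 length_Suc_conv)
      then have "(x', y') \<in> supp X (f \<alpha>)"
        using z \<alpha> by (simp add: supp_eq[OF hom] in_keys_iff)
      then have cases: "pair_prec k A (x, y) (x', y') \<or> pair_prec k A (x', y') (x, y)"
        using chain[OF \<alpha>(1)] \<alpha>(2) z(2) xy'(1) unfolding pred_on.chain_def by blast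
      let ?w = "u @ z @ v"
      have w': "?w \<in> lists X" "length ?w = k + 1"
        using X xy' less.prems(2) by (auto simp: w)
      have same: "?W ?w j = ?W w j" if "j < i" for j
        using that len by (simp add: w nth_append)
      have new: "?W ?w i = c x'" "?W ?w (Suc i) = c y'"
        using len xy'(1) by (simp_all add: nth_append)
      have "rank k (?W w) < rank k (?W ?w)"
        using cases
      proof
        \<comment> \<open>Here \<open>c x' \<ge> c y' > c x \<ge> Suc i\<close>, so neither of the
          two places is low any more.\<close>
        assume "pair_prec k A (x, y) (x', y')"
        from prec[OF this] show ?thesis
          using same new cx W[OF w', of k] by (intro rank_less_up[OF i]) (auto simp: x_def)
      next
        \<comment> \<open>Here \<open>c x' < c y \<le> Suc i\<close>, so place \<open>i\<close>
          becomes low.\<close>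
        assume "pair_prec k A (x', y') (x, y)"
        from prec[OF this] show ?thesis
          using same new cy W[OF less.prems, of i] \<open>Suc i \<le> k\<close>
          by (intro rank_less_down[OF i]) auto
      qed
      then show "Poly_Mapping.single ?w (1 :: 'k) \<in> I"
        by (intro IH w')
    qed
    then show ?case
      by (simp add: w)
  qed
qed

theorem theorem1p7:
  fixes X :: "'x set" and A :: "nat \<Rightarrow> 'x set" and k :: nat
    and \<Lambda> :: "'l set" and f :: "'l \<Rightarrow> ('x list \<Rightarrow>\<^sub>0 'k::field)"
  assumes "k \<ge> 1"
    and "indexed_partition k A X"
    and "\<And>\<alpha>. \<alpha> \<in> \<Lambda> \<Longrightarrow> f \<alpha> \<in> homogeneous_component X 2"
    and "(\<Union>\<alpha>\<in>\<Lambda>. supp X (f \<alpha>)) = pair_set k A"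
    and "\<And>\<alpha>. \<alpha> \<in> \<Lambda> \<Longrightarrow> pred_on.chain (pair_set k A) (pair_prec k A) (supp X (f \<alpha>))"
  shows "step_nilpotent
    (free_algebra X Quot (Idl\<^bsub>free_algebra X\<^esub> (f ` \<Lambda>)))
    (quotient_component X (Idl\<^bsub>free_algebra X\<^esub> (f ` \<Lambda>)))
    (k + 1)"
proof -
  let ?F = "free_algebra X :: ('x list \<Rightarrow>\<^sub>0 'k) ring"
  let ?I = "Idl\<^bsub>?F\<^esub> (f ` \<Lambda>)"
  have sub: "f ` \<Lambda> \<subseteq> carrier ?F"
    using assms(3) by (auto simp: homogeneous_component_def)
  have I: "ideal ?I ?F"
    by (rule ring.genideal_ideal[OF ring_free_algebra sub])
  have fI: "f ` \<Lambda> \<subseteq> ?I"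
    by (rule ring.genideal_self[OF ring_free_algebra sub])
  have "?I +>\<^bsub>?F\<^esub> p = ?I" if "p \<in> homogeneous_component X (k + 1)" for p
  proof -
    have "p \<in> ?I"
    proof (rule ideal_free_algebra_keys[OF I])
      fix w assume "w \<in> Poly_Mapping.keys p"
      then have "w \<in> lists X" "length w = k + 1"
        using that by (auto simp: homogeneous_component_def free_algebra_def)
      then show "Poly_Mapping.single w (1 :: 'k) \<in> ?I"
        using assms(2-5) I fI by (intro long_word_in_ideal[where I = ?I and f = f and \<Lambda> = \<Lambda>]) auto
    qed
    then show ?thesis
      using ideal.axioms(1)[OF I] ring.is_abelian_group[OF ring_free_algebra]
      by (intro abelian_subgroup.a_rcos_const abelian_subgroupI3)
  qed
  \<comment> \<open>The component is to equal the singleton of zero, so it must also be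
    nonempty.\<close>
  moreover have "0 \<in> homogeneous_component X (k + 1)"
    by (simp add: homogeneous_component_def free_algebra_def)
  ultimately show ?thesis
    unfolding step_nilpotent_def quotient_component_def FactRing_def by auto
qed

end
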